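(* Let $R$ be a nonzero commutative (associative) ring with unity of characteristic not equal to $2$. Then for every integer $n>3$ the quandle ring $R[\mathrm{R}_n]$ of the dihedral quandle $\mathrm{R}_n$ is not power-associative.
   Context: The dihedral quandle $\mathrm{R}_n=\{a_0,\dots,a_{n-1}\}$ has operation $a_i.a_j=a_{2j-i}$, indices modulo $n$. $R[\mathrm{R}_n]$ is the free $R$-module on $\mathrm{R}_n$ with the $R$-bilinear extension of this operation as (non-associative) multiplication. A (not necessarily associative) ring is power-associative if every element generates an associative subring. *)

theory Defs
  imports "HOL-Library.Poly_Mapping"
begin

(* The element a_i of the dihedral quandle R_n is represented by the residue i in {0..<n}. *)

definition dihedral_quandle :: "nat \<Rightarrow> int set" where
  "dihedral_quandle n = {0..<int n}"

definition dihedral_op :: "nat \<Rightarrow> int \<Rightarrow> int \<Rightarrow> int" where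
  "dihedral_op n i j = (2 * j - i) mod int n"

(* The free R-module on X consists of the finitely supported functions with support in X; the
   basis element x is Poly_Mapping.single x 1.  The product is the R-bilinear extension of the
   operation op on the basis.  It is unrelated to the convolution product that Poly_Mapping
   puts on the same type. *)

definition quandle_ring :: "'q set \<Rightarrow> ('q \<Rightarrow>\<^sub>0 'r::comm_ring_1) set" where
  "quandle_ring X = {f. Poly_Mapping.keys f \<subseteq> X}"

definition quandle_ring_mult ::
    "('q \<Rightarrow> 'q \<Rightarrow> 'q) \<Rightarrow> ('q \<Rightarrow>\<^sub>0 'r::comm_ring_1) \<Rightarrow> ('q \<Rightarrow>\<^sub>0 'r) \<Rightarrow> ('q \<Rightarrow>\<^sub>0 'r)" where
  "quandle_ring_mult op f g =
     (\<Sum>x\<in>Poly_Mapping.keys f. \<Sum>y\<in>Poly_Mapping.keys g.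
        Poly_Mapping.single (op x y) (Poly_Mapping.lookup f x * Poly_Mapping.lookup g y))"

(* A not necessarily associative (nor unital) ring is given by its carrier A, a subgroup of the
   additive group of the ambient type, and its multiplication mult. *)

definition nonassoc_subring :: "'a::ab_group_add set \<Rightarrow> ('a \<Rightarrow> 'a \<Rightarrow> 'a) \<Rightarrow> 'a set \<Rightarrow> bool" where
  "nonassoc_subring A mult S \<longleftrightarrow>
     S \<subseteq> A \<and> 0 \<in> S \<and> (\<forall>x\<in>S. \<forall>y\<in>S. x - y \<in> S \<and> mult x y \<in> S)"

definition subring_generated_by :: "'a::ab_group_add set \<Rightarrow> ('a \<Rightarrow> 'a \<Rightarrow> 'a) \<Rightarrow> 'a \<Rightarrow> 'a set" where
  "subring_generated_by A mult u = \<Inter>{S. nonassoc_subring A mult S \<and> u \<in> S}"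

definition power_associative :: "'a::ab_group_add set \<Rightarrow> ('a \<Rightarrow> 'a \<Rightarrow> 'a) \<Rightarrow> bool" where
  "power_associative A mult \<longleftrightarrow>
     (\<forall>u\<in>A. \<forall>x\<in>subring_generated_by A mult u. \<forall>y\<in>subring_generated_by A mult u.
        \<forall>z\<in>subring_generated_by A mult u. mult (mult x y) z = mult x (mult y z))"

lemma quandle_ring_mult_single:
  "quandle_ring_mult op (Poly_Mapping.single x a) (Poly_Mapping.single y b) =
     Poly_Mapping.single (op x y) (a * b)"
  by (auto simp: quandle_ring_mult_def)

lemma quandle_ring_mult_superset:
  assumes "finite F" "finite G" "Poly_Mapping.keys f \<subseteq> F" "Poly_Mapping.keys g \<subseteq> G"
  shows "quandle_ring_mult op f g =
     (\<Sum>x\<in>F. \<Sum>y\<in>G.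
        Poly_Mapping.single (op x y) (Poly_Mapping.lookup f x * Poly_Mapping.lookup g y))"
proof -
  have "(\<Sum>y\<in>Poly_Mapping.keys g.
        Poly_Mapping.single (op x y) (Poly_Mapping.lookup f x * Poly_Mapping.lookup g y)) =
      (\<Sum>y\<in>G. Poly_Mapping.single (op x y) (Poly_Mapping.lookup f x * Poly_Mapping.lookup g y))"
    for x
    by (rule sum.mono_neutral_left) (use assms in \<open>auto simp: in_keys_iff\<close>)
  then have "quandle_ring_mult op f g = (\<Sum>x\<in>Poly_Mapping.keys f. \<Sum>y\<in>G.
        Poly_Mapping.single (op x y) (Poly_Mapping.lookup f x * Poly_Mapping.lookup g y))"
    by (simp add: quandle_ring_mult_def)
  also have "\<dots> = (\<Sum>x\<in>F. \<Sum>y\<in>G.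
        Poly_Mapping.single (op x y) (Poly_Mapping.lookup f x * Poly_Mapping.lookup g y))"
    by (rule sum.mono_neutral_left) (use assms in \<open>auto simp: in_keys_iff\<close>)
  finally show ?thesis .
qed

lemma quandle_ring_mult_add_left:
  "quandle_ring_mult op (f + g) h = quandle_ring_mult op f h + quandle_ring_mult op g h"
proof -
  let ?F = "Poly_Mapping.keys f \<union> Poly_Mapping.keys g" and ?H = "Poly_Mapping.keys h"
  have "Poly_Mapping.keys (f + g) \<subseteq> ?F" by (rule Poly_Mapping.keys_add)
  then show ?thesis
    by (subst (1 2 3) quandle_ring_mult_superset[of ?F ?H])
       (auto simp: lookup_add distrib_right single_add sum.distrib)
qed

lemma quandle_ring_mult_add_right:
  "quandle_ring_mult op h (f + g) = quandle_ring_mult op h f + quandle_ring_mult op h g"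
proof -
  let ?F = "Poly_Mapping.keys f \<union> Poly_Mapping.keys g" and ?H = "Poly_Mapping.keys h"
  have "Poly_Mapping.keys (f + g) \<subseteq> ?F" by (rule Poly_Mapping.keys_add)
  then show ?thesis
    by (subst (1 2 3) quandle_ring_mult_superset[of ?H ?F])
       (auto simp: lookup_add distrib_left single_add sum.distrib)
qed

lemma nonassoc_subring_dihedral:
  assumes "n > 0"
  shows "nonassoc_subring (quandle_ring (dihedral_quandle n) :: (int \<Rightarrow>\<^sub>0 'r::comm_ring_1) set)
           (quandle_ring_mult (dihedral_op n)) (quandle_ring (dihedral_quandle n))"
proof -
  have "Poly_Mapping.keys (f - g) \<subseteq> dihedral_quandle n"
    if "Poly_Mapping.keys f \<subseteq> dihedral_quandle n" "Poly_Mapping.keys g \<subseteq> dihedral_quandle n"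
    for f g :: "int \<Rightarrow>\<^sub>0 'r"
    using that by (simp add: in_keys_iff lookup_minus subset_iff) (metis diff_self)
  moreover have "Poly_Mapping.keys (quandle_ring_mult (dihedral_op n) f g) \<subseteq> dihedral_quandle n"
    for f g :: "int \<Rightarrow>\<^sub>0 'r"
  proof -
    have "dihedral_op n x y \<in> dihedral_quandle n" for x y
      using assms by (auto simp: dihedral_op_def dihedral_quandle_def)
    then show ?thesis
      unfolding quandle_ring_mult_def
      by (intro order.trans[OF keys_sum] UN_least) (auto split: if_splits)
  qed
  ultimately show ?thesis
    by (auto simp: nonassoc_subring_def quandle_ring_def)
qed

end

(* For u = a_0 - a_1 one finds
     (u u) u - u (u u) = a_0 - a_1 - 2 a_2 + 2 a_{-1} + a_4 - a_{-3}.
   Its coefficient at a_0 is 1 if n > 4, and 2 if n = 4, because then a_4 = a_0; hence it is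
   nonzero and u does not generate an associative subring. *)

theory Submission
  imports Defs
begin

text \<open>\<open>u\<close> lies in every subring over which the intersection is taken, so the
  three factors may all be \<open>u\<close>.\<close>

lemma power_associative_cube:
  assumes "power_associative A mult" "u \<in> A"
  shows "mult (mult u u) u = mult u (mult u u)"
  using assms by (auto simp: power_associative_def subring_generated_by_def)

text \<open>Lets products be computed on unreduced integer indices, uniformly in \<open>n\<close>;
  this is why \<open>u\<close> below is written with \<open>0 mod int n\<close> and
  \<open>1 mod int n\<close>.\<close>

lemma dihedral_op_mod [simp]:
  "dihedral_op n (i mod int n) (j mod int n) = (2 * j - i) mod int n"
  unfolding dihedral_op_def by (metis mod_diff_cong mod_mod_trivial mod_mult_right_eq)

lemma mod_eq_0_iff_of_abs_less:
  fixes k m :: int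
  assumes "\<bar>k\<bar> < m"
  shows "k mod m = 0 \<longleftrightarrow> k = 0"
proof
  assume "k mod m = 0"
  then have "m dvd k" by (simp add: mod_eq_0_iff_dvd)
  then show "k = 0" using dvd_imp_le_int[of k m] assms by auto
qed simp

lemma dihedral_cube_coeff:
  fixes n :: nat and u :: "int \<Rightarrow>\<^sub>0 'r::comm_ring_1"
  assumes "n > 3"
  defines "u \<equiv> Poly_Mapping.single (0 mod int n) 1 + Poly_Mapping.single (1 mod int n) (- 1)"
    and "mult \<equiv> quandle_ring_mult (dihedral_op n)"
  shows "Poly_Mapping.lookup (mult (mult u u) u) 0 - Poly_Mapping.lookup (mult u (mult u u)) 0
           = (if n = 4 then 2 else 1)"
proof -
  have uu: "mult u u = Poly_Mapping.single (0 mod int n) 1 + Poly_Mapping.single (1 mod int n) 1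
      + Poly_Mapping.single (2 mod int n) (- 1) + Poly_Mapping.single (- 1 mod int n) (- 1)"
    unfolding u_def mult_def quandle_ring_mult_add_left quandle_ring_mult_add_right
      quandle_ring_mult_single dihedral_op_mod by simp
  \<comment> \<open>Both cubes involve only indices from -3 to 4. As \<open>n > 3\<close>, the index
    4 is the only nonzero one that can reduce to 0.\<close>
  have "k mod int n = 0 \<longleftrightarrow> k = 0" if "\<bar>k\<bar> < 4" for k
    using that assms(1) by (intro mod_eq_0_iff_of_abs_less) auto
  moreover have "4 mod int n = 0 \<longleftrightarrow> n = 4"
    using assms(1) mod_eq_0_iff_of_abs_less[of 4 "int n"] by (cases "n = 4") auto
  ultimately show ?thesis
    unfolding uu
    unfolding u_def mult_def quandle_ring_mult_add_left quandle_ring_mult_add_right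
      quandle_ring_mult_single dihedral_op_mod lookup_add lookup_single
    by (auto simp: when_def)
qed

theorem proposition7p3:
  fixes n :: nat
  assumes "CHAR('r::comm_ring_1) \<noteq> 2"
    and "n > 3"
  shows "\<not> power_associative
             (quandle_ring (dihedral_quandle n) :: (int \<Rightarrow>\<^sub>0 'r) set)
             (quandle_ring_mult (dihedral_op n))"
proof
  assume pa: "power_associative (quandle_ring (dihedral_quandle n) :: (int \<Rightarrow>\<^sub>0 'r) set)
                (quandle_ring_mult (dihedral_op n))"
  let ?u = "Poly_Mapping.single (0 mod int n) 1 + Poly_Mapping.single (1 mod int n) (- 1)
              :: int \<Rightarrow>\<^sub>0 'r"
  have "Poly_Mapping.keys ?u \<subseteq> {0 mod int n} \<union> {1 mod int n}"
    by (rule order.trans[OF Poly_Mapping.keys_add]) auto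
  then have "?u \<in> quandle_ring (dihedral_quandle n)"
    using assms(2) by (auto simp: quandle_ring_def dihedral_quandle_def)
  from power_associative_cube[OF pa this] have "(if n = 4 then 2 else 1) = (0 :: 'r)"
    using dihedral_cube_coeff[OF assms(2), where 'r = 'r] by simp
  \<comment> \<open>For \<open>n \<noteq> 4\<close> the equation reads 1 = 0, which is absurd in
    \<open>'r\<close>; hence 2 = 0.\<close>
  then have "of_nat 2 = (0 :: 'r)"
    by (auto split: if_splits)
  then have "CHAR('r) dvd 2"
    by (simp only: of_nat_eq_0_iff_char_dvd)
  \<comment> \<open>A divisor of 2 is 1 or 2, and characteristic 1 would force 1 = 0.\<close>
  then have "CHAR('r) \<le> 2" "CHAR('r) \<noteq> 0"
    by (auto dest: dvd_imp_le intro: Nat.gr0I)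
  then show False
    using assms(1) CHAR_not_1[where 'a = 'r] by linarith
qed

end
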